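(* Let $p$ be a prime, $n\ge1$, $\boldsymbol{\alpha}=(\alpha_1,\ldots,\alpha_n)\in\mathbb{Z}_{\ge0}^n$, and let $F(\boldsymbol{x})=\sum_{\boldsymbol{m}\in\mathbb{Z}_{\ge0}^n}A_{\boldsymbol{m}}E_{\boldsymbol{m}}(\boldsymbol{x})$ be a continuous function from $\mathbb{Z}_p^n$ to $\mathbb{Z}_p$, written in its van der Put expansion. If $F$ is a $p^{\boldsymbol{\alpha}}$-Lipschitz function, then for every $\boldsymbol{m}=(m_1,\ldots,m_n)\in\mathbb{Z}_{\ge0}^n$ with $I(\boldsymbol{m})=\{i:\ m_i\ge p\}\neq\emptyset$, $$|A_{m_1,\ldots,m_n}|_p\le p^{\min_{i\in I(\boldsymbol{m})}\{-\lfloor\log_p m_i\rfloor+\alpha_i\}}.$$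
   Context: A function $F:\mathbb{Z}_p^n\to\mathbb{Z}_p$ is $p^{\boldsymbol{\alpha}}$-Lipschitz if for all $\boldsymbol{x},\boldsymbol{y}\in\mathbb{Z}_p^n$, $|F(\boldsymbol{x})-F(\boldsymbol{y})|_p\le\max_{1\le i\le n}\{p^{\alpha_i}|x_i-y_i|_p\}$. Van der Put basis: write $x\in\mathbb{Z}_p$ as $x=\sum_{i\ge0}x_ip^i$ with $x_i\in\{0,\ldots,p-1\}$. For $m\in\mathbb{Z}_{\ge0}$ let $e_m(x)=1$ if $m$ is one of the numbers $x_0+x_1p+\cdots+x_Np^N$, $N\ge0$, and $e_m(x)=0$ otherwise. Put $E_{\boldsymbol{m}}(\boldsymbol{x})=e_{m_1}(x_1)\cdots e_{m_n}(x_n)$. Every continuous $F:\mathbb{Z}_p^n\to\mathbb{Q}_p$ has a unique uniformly convergent expansion $F=\sum_{\boldsymbol{m}}A_{\boldsymbol{m}}E_{\boldsymbol{m}}$ with $A_{\boldsymbol{m}}\in\mathbb{Q}_p$ (its van der Put expansion). $I(\boldsymbol{m})$ is the set of indices $i\in\{1,\ldots,n\}$ with $m_i\ge p$. *)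

theory Defs
  imports "HOL-Analysis.Analysis" "Berlekamp_Zassenhaus.Finite_Field"
begin

section \<open>The \<open>p\<close>-adic absolute value on the rationals\<close>

definition rat_padic_abs :: "nat \<Rightarrow> rat \<Rightarrow> real" where
  "rat_padic_abs p q =
     (if q = 0 then 0
      else (case quotient_of q of (a, b) \<Rightarrow>
        real p powi (int (multiplicity (int p) b) - int (multiplicity (int p) a))))"

definition padic_vanishes :: "nat \<Rightarrow> (nat \<Rightarrow> rat) \<Rightarrow> bool" where
  "padic_vanishes p X \<longleftrightarrow> (\<lambda>n. rat_padic_abs p (X n)) \<longlonglongrightarrow> 0"

definition padic_cauchy :: "nat \<Rightarrow> (nat \<Rightarrow> rat) \<Rightarrow> bool" where
  "padic_cauchy p X \<longleftrightarrow>
     (\<forall>e>0. \<exists>N. \<forall>m\<ge>N. \<forall>n\<ge>N. rat_padic_abs p (X m - X n) < e)"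

lemma rat_padic_abs_0 [simp]: "rat_padic_abs p 0 = 0"
  by (simp add: rat_padic_abs_def)

lemma padic_cauchy_filter:
  "padic_cauchy p X \<longleftrightarrow>
     ((\<lambda>(m, n). rat_padic_abs p (X m - X n)) \<longlongrightarrow> 0) (sequentially \<times>\<^sub>F sequentially)"
proof -
  have nn: "rat_padic_abs p q \<ge> 0" for q
    by (auto simp: rat_padic_abs_def split: prod.splits)
  show ?thesis
    unfolding padic_cauchy_def tendsto_iff eventually_prod_sequentially
    using nn by (auto simp: dist_real_def abs_of_nonneg; blast)
qed

context
  fixes p :: nat
  assumes p: "prime p"
begin

lemma p_gt_1: "real p > 1"
  using p prime_gt_1_nat by auto

lemma p_int: "prime_elem (int p)"
  using p by auto

lemma rat_padic_abs_divide:
  assumes "a \<noteq> 0" "b \<noteq> 0"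
  shows "rat_padic_abs p (of_int a / of_int b) =
    real p powi (int (multiplicity (int p) b) - int (multiplicity (int p) a))"
proof -
  define q :: rat where "q = of_int a / of_int b"
  obtain c d where cd: "quotient_of q = (c, d)" by fastforce
  have q: "q = of_int c / of_int d" and d: "d > 0"
    using quotient_of_div[OF cd] quotient_of_denom_pos[OF cd] by auto
  have q0: "q \<noteq> 0" using assms by (simp add: q_def)
  have c: "c \<noteq> 0" using q0 q by auto
  have "of_int (a * d) = (of_int (c * b) :: rat)"
    using q assms d unfolding q_def by (simp add: field_simps)
  hence "a * d = c * b" using of_int_eq_iff by blast
  hence "multiplicity (int p) (a * d) = multiplicity (int p) (c * b)" by simp
  hence "multiplicity (int p) a + multiplicity (int p) d =
      multiplicity (int p) c + multiplicity (int p) b"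
    using p_int assms c d by (simp add: prime_elem_multiplicity_mult_distrib)
  hence "int (multiplicity (int p) d) - int (multiplicity (int p) c) =
      int (multiplicity (int p) b) - int (multiplicity (int p) a)"
    by linarith
  thus ?thesis
    using q0 unfolding q_def[symmetric] by (simp add: rat_padic_abs_def cd)
qed

lemma rat_padic_abs_nonneg: "rat_padic_abs p q \<ge> 0"
  by (auto simp: rat_padic_abs_def split: prod.splits)

lemma rat_padic_abs_eq_0_iff: "rat_padic_abs p q = 0 \<longleftrightarrow> q = 0"
  using p_gt_1 by (auto simp: rat_padic_abs_def split: prod.splits)

lemma rat_as_quotient:
  obtains a b where "(q :: rat) = of_int a / of_int b" "b \<noteq> 0"
proof -
  obtain c d where cd: "quotient_of q = (c, d)" by fastforce
  show ?thesis
    using that[of c d] quotient_of_div[OF cd] quotient_of_denom_pos[OF cd] by auto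
qed

lemma rat_padic_abs_mult: "rat_padic_abs p (q * r) = rat_padic_abs p q * rat_padic_abs p r"
proof (cases "q = 0 \<or> r = 0")
  case False
  obtain a b where ab: "q = of_int a / of_int b" "b \<noteq> 0" by (rule rat_as_quotient)
  obtain c d where cd: "r = of_int c / of_int d" "d \<noteq> 0" by (rule rat_as_quotient)
  have ac: "a \<noteq> 0" "c \<noteq> 0" using False ab cd by auto
  have "q * r = of_int (a * c) / of_int (b * d)" by (simp add: ab cd)
  hence "rat_padic_abs p (q * r) =
    real p powi (int (multiplicity (int p) (b * d)) - int (multiplicity (int p) (a * c)))"
    using rat_padic_abs_divide[of "a * c" "b * d"] ac ab cd by simp
  also have "\<dots> = real p powi ((int (multiplicity (int p) b) - int (multiplicity (int p) a))
      + (int (multiplicity (int p) d) - int (multiplicity (int p) c)))"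
    using ac ab cd p_int
    by (simp add: prime_elem_multiplicity_mult_distrib algebra_simps)
  also have "\<dots> = rat_padic_abs p q * rat_padic_abs p r"
    using p_gt_1 ac ab cd by (simp add: power_int_add rat_padic_abs_divide)
  finally show ?thesis .
qed auto

lemma rat_padic_abs_1: "rat_padic_abs p 1 = 1"
  using rat_padic_abs_divide[of 1 1] by simp

lemma rat_padic_abs_minus: "rat_padic_abs p (- q) = rat_padic_abs p q"
proof -
  have "(rat_padic_abs p (- 1))\<^sup>2 = 1"
    using rat_padic_abs_mult[of "- 1" "- 1"] rat_padic_abs_1 by (simp add: power2_eq_square)
  hence "rat_padic_abs p (- 1) = 1"
    using rat_padic_abs_nonneg[of "- 1"] by (auto simp: power2_eq_1_iff)
  thus ?thesis using rat_padic_abs_mult[of "- 1" q] by simp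
qed

lemma rat_padic_abs_minus_commute: "rat_padic_abs p (q - r) = rat_padic_abs p (r - q)"
  using rat_padic_abs_minus[of "q - r"] by simp

lemma rat_padic_abs_of_int_le: "rat_padic_abs p (of_int a) \<le> 1"
proof (cases "a = 0")
  case False
  thus ?thesis
    using rat_padic_abs_divide[of a 1] p_gt_1
    by (simp add: power_int_minus inverse_le_1_iff)
qed auto

lemma rat_padic_abs_add_le_max:
  "rat_padic_abs p (q + r) \<le> max (rat_padic_abs p q) (rat_padic_abs p r)"
proof (cases "q = 0 \<or> r = 0 \<or> q + r = 0")
  case True
  thus ?thesis using rat_padic_abs_nonneg by (auto simp: le_max_iff_disj)
next
  case False
  obtain a b where ab: "q = of_int a / of_int b" "b \<noteq> 0" by (rule rat_as_quotient)
  obtain c d where cd: "r = of_int c / of_int d" "d \<noteq> 0" by (rule rat_as_quotient)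
  define u where "u = a * d"
  define v where "v = c * b"
  have q: "q = of_int u / of_int (b * d)" and r: "r = of_int v / of_int (b * d)"
    using ab cd by (simp_all add: u_def v_def)
  have qr: "q + r = of_int (u + v) / of_int (b * d)"
    by (simp add: q r add_divide_distrib)
  have nz: "u \<noteq> 0" "v \<noteq> 0" "u + v \<noteq> 0" "b * d \<noteq> 0"
    using False q r qr ab cd by auto
  let ?m = "multiplicity (int p)"
  have "int p ^ min (?m u) (?m v) dvd u + v"
    by (intro dvd_add multiplicity_dvd') auto
  hence "min (?m u) (?m v) \<le> ?m (u + v)"
    using nz p_int prime_elem_def by (intro multiplicity_geI) auto
  hence "?m u \<le> ?m (u + v) \<or> ?m v \<le> ?m (u + v)" by linarith
  hence "real p powi (int (?m (b*d)) - int (?m (u+v))) \<le> real p powi (int (?m (b*d)) - int (?m u)) \<or>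
     real p powi (int (?m (b*d)) - int (?m (u+v))) \<le> real p powi (int (?m (b*d)) - int (?m v))"
    using p_gt_1 by (auto intro!: power_int_increasing)
  thus ?thesis
    using rat_padic_abs_divide[of u "b * d"] rat_padic_abs_divide[of v "b * d"]
      rat_padic_abs_divide[of "u + v" "b * d"] nz
    unfolding qr unfolding q r by (simp only: le_max_iff_disj not_False_eq_True simp_thms)
qed

lemma rat_padic_abs_triangle: "rat_padic_abs p (q + r) \<le> rat_padic_abs p q + rat_padic_abs p r"
  using rat_padic_abs_add_le_max[of q r] rat_padic_abs_nonneg[of q] rat_padic_abs_nonneg[of r]
  by linarith

lemma rat_padic_abs_triangle_rev:
  "\<bar>rat_padic_abs p q - rat_padic_abs p r\<bar> \<le> rat_padic_abs p (q - r)"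
  using rat_padic_abs_triangle[of "q - r" r] rat_padic_abs_triangle[of "r - q" q]
    rat_padic_abs_minus_commute[of q r] by auto

lemma rat_padic_abs_inverse: "rat_padic_abs p (inverse q) = inverse (rat_padic_abs p q)"
proof (cases "q = 0")
  case False
  thus ?thesis
    using rat_padic_abs_mult[of q "inverse q"] rat_padic_abs_1
    by (simp add: field_simps rat_padic_abs_eq_0_iff)
qed auto

lemma vanishing_add:
  assumes "((\<lambda>x. rat_padic_abs p (f x)) \<longlongrightarrow> 0) F" "((\<lambda>x. rat_padic_abs p (g x)) \<longlongrightarrow> 0) F"
  shows "((\<lambda>x. rat_padic_abs p (f x + g x)) \<longlongrightarrow> 0) F"
proof (rule tendsto_sandwich[OF _ _ tendsto_const])
  show "((\<lambda>x. rat_padic_abs p (f x) + rat_padic_abs p (g x)) \<longlongrightarrow> 0) F"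
    using tendsto_add[OF assms] by simp
qed (auto simp: rat_padic_abs_nonneg rat_padic_abs_triangle)

lemma vanishing_mult:
  assumes "((\<lambda>x. rat_padic_abs p (f x)) \<longlongrightarrow> 0) F" "eventually (\<lambda>x. rat_padic_abs p (g x) \<le> B) F"
  shows "((\<lambda>x. rat_padic_abs p (f x * g x)) \<longlongrightarrow> 0) F"
proof (rule tendsto_sandwich[OF _ _ tendsto_const])
  show "((\<lambda>x. rat_padic_abs p (f x) * B) \<longlongrightarrow> 0) F"
    using tendsto_mult_left_zero[OF assms(1)] by simp
  show "eventually (\<lambda>x. rat_padic_abs p (f x * g x) \<le> rat_padic_abs p (f x) * B) F"
    using assms(2)
    by eventually_elim (simp add: rat_padic_abs_mult rat_padic_abs_nonneg mult_left_mono)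
qed (auto simp: rat_padic_abs_nonneg)

lemma padic_cauchy_imp_convergent_abs:
  assumes "padic_cauchy p X"
  shows "convergent (\<lambda>n. rat_padic_abs p (X n))"
proof -
  have "Cauchy (\<lambda>n. rat_padic_abs p (X n))"
    unfolding Cauchy_def dist_real_def
    using assms unfolding padic_cauchy_def
    by (meson le_less_trans rat_padic_abs_triangle_rev)
  thus ?thesis by (simp add: Cauchy_convergent_iff)
qed

lemma padic_cauchy_imp_bounded:
  assumes "padic_cauchy p X"
  obtains B where "\<And>n. rat_padic_abs p (X n) \<le> B"
  using convergent_imp_Bseq[OF padic_cauchy_imp_convergent_abs[OF assms]]
  by (auto simp: Bseq_def rat_padic_abs_nonneg)

lemma padic_cauchy_const: "padic_cauchy p (\<lambda>n. c)"
  by (simp add: padic_cauchy_def)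

lemma padic_cauchy_minus: "padic_cauchy p X \<Longrightarrow> padic_cauchy p (\<lambda>n. - X n)"
  unfolding padic_cauchy_def using rat_padic_abs_minus_commute by simp

lemma padic_cauchy_add:
  assumes "padic_cauchy p X" "padic_cauchy p Y"
  shows "padic_cauchy p (\<lambda>n. X n + Y n)"
  using vanishing_add[OF assms[unfolded padic_cauchy_filter case_prod_unfold]]
  unfolding padic_cauchy_filter case_prod_unfold by (simp add: algebra_simps)

lemma padic_cauchy_mult:
  assumes X: "padic_cauchy p X" and Y: "padic_cauchy p Y"
  shows "padic_cauchy p (\<lambda>n. X n * Y n)"
proof -
  obtain B C where B: "\<And>n. rat_padic_abs p (X n) \<le> B" and C: "\<And>n. rat_padic_abs p (Y n) \<le> C"
    using padic_cauchy_imp_bounded[OF X] padic_cauchy_imp_bounded[OF Y] by metis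
  have "((\<lambda>z. rat_padic_abs p ((X (fst z) - X (snd z)) * Y (snd z))) \<longlongrightarrow> 0) (sequentially \<times>\<^sub>F sequentially)"
    using X C unfolding padic_cauchy_filter case_prod_unfold
    by (intro vanishing_mult[where B = C]) auto
  moreover have "((\<lambda>z. rat_padic_abs p ((Y (fst z) - Y (snd z)) * X (fst z))) \<longlongrightarrow> 0) (sequentially \<times>\<^sub>F sequentially)"
    using Y B unfolding padic_cauchy_filter case_prod_unfold
    by (intro vanishing_mult[where B = B]) auto
  ultimately show ?thesis
    unfolding padic_cauchy_filter case_prod_unfold
    by (drule_tac vanishing_add) (assumption, simp add: algebra_simps)
qed

lemma padic_cauchy_not_vanishes:
  assumes X: "padic_cauchy p X" and nz: "\<not> padic_vanishes p X"
  obtains c where "c > 0" "eventually (\<lambda>n. rat_padic_abs p (X n) > c) sequentially"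
proof -
  obtain L where L: "(\<lambda>n. rat_padic_abs p (X n)) \<longlonglongrightarrow> L"
    using padic_cauchy_imp_convergent_abs[OF X] by (auto simp: convergent_def)
  have "L \<ge> 0" using L rat_padic_abs_nonneg by (intro LIMSEQ_le_const) auto
  moreover have "L \<noteq> 0" using L nz by (auto simp: padic_vanishes_def)
  ultimately have "L > 0" by simp
  thus ?thesis
    using that[of "L / 2"] order_tendstoD(1)[OF L, of "L / 2"] by simp
qed

lemma vanishing_inverse_diff:
  assumes fg: "((\<lambda>x. rat_padic_abs p (f x - g x)) \<longlongrightarrow> 0) F"
    and f: "eventually (\<lambda>x. rat_padic_abs p (f x) > c) F"
    and g: "eventually (\<lambda>x. rat_padic_abs p (g x) > d) F" and cd: "c > 0" "d > 0"
  shows "((\<lambda>x. rat_padic_abs p (inverse (f x) - inverse (g x))) \<longlongrightarrow> 0) F"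
proof -
  have "eventually (\<lambda>x. rat_padic_abs p (inverse (f x) * inverse (g x)) \<le> inverse c * inverse d) F"
    using f g by eventually_elim
      (use cd in \<open>auto simp: rat_padic_abs_mult rat_padic_abs_inverse rat_padic_abs_nonneg
         intro!: mult_mono le_imp_inverse_le\<close>)
  from vanishing_mult[OF fg this]
  have *: "((\<lambda>x. rat_padic_abs p ((f x - g x) * (inverse (f x) * inverse (g x)))) \<longlongrightarrow> 0) F" .
  have "eventually (\<lambda>x. rat_padic_abs p ((f x - g x) * (inverse (f x) * inverse (g x)))
      = rat_padic_abs p (inverse (f x) - inverse (g x))) F"
    using f g
  proof eventually_elim
    case (elim x)
    hence "f x \<noteq> 0" "g x \<noteq> 0" using cd by auto
    hence "(f x - g x) * (inverse (f x) * inverse (g x)) = - (inverse (f x) - inverse (g x))"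
      by (simp add: field_simps)
    thus ?case by (simp only: rat_padic_abs_minus)
  qed
  from Lim_transform_eventually[OF * this] show ?thesis .
qed

lemma padic_cauchy_inverse:
  assumes X: "padic_cauchy p X" and nz: "\<not> padic_vanishes p X"
  shows "padic_cauchy p (\<lambda>n. inverse (X n))"
proof -
  obtain c where c: "c > 0" "eventually (\<lambda>n. rat_padic_abs p (X n) > c) sequentially"
    using padic_cauchy_not_vanishes[OF assms] .
  have "eventually (\<lambda>z. rat_padic_abs p (X (fst z)) > c) (sequentially \<times>\<^sub>F sequentially)"
    "eventually (\<lambda>z. rat_padic_abs p (X (snd z)) > c) (sequentially \<times>\<^sub>F sequentially)"
    using eventually_compose_filterlim[OF c(2) filterlim_fst]
      eventually_compose_filterlim[OF c(2) filterlim_snd] .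
  from vanishing_inverse_diff[OF _ this c(1) c(1)] show ?thesis
    using X unfolding padic_cauchy_filter case_prod_unfold by simp
qed

lemma padic_vanishes_add:
  "padic_vanishes p X \<Longrightarrow> padic_vanishes p Y \<Longrightarrow> padic_vanishes p (\<lambda>n. X n + Y n)"
  unfolding padic_vanishes_def by (rule vanishing_add)

lemma padic_vanishes_minus: "padic_vanishes p X \<Longrightarrow> padic_vanishes p (\<lambda>n. - X n)"
  unfolding padic_vanishes_def by (simp add: rat_padic_abs_minus)

lemma padic_vanishes_mult:
  assumes "padic_vanishes p X" "padic_cauchy p Y"
  shows "padic_vanishes p (\<lambda>n. X n * Y n)"
proof -
  obtain C where C: "\<And>n. rat_padic_abs p (Y n) \<le> C"
    using padic_cauchy_imp_bounded[OF assms(2)] by blast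
  thus ?thesis
    using assms(1) unfolding padic_vanishes_def by (intro vanishing_mult[where B = C]) auto
qed

lemma padic_vanishes_imp_cauchy:
  assumes "padic_vanishes p X" shows "padic_cauchy p X"
proof -
  have "((\<lambda>z. rat_padic_abs p (X (fst z))) \<longlongrightarrow> 0) (sequentially \<times>\<^sub>F sequentially)"
    "((\<lambda>z. rat_padic_abs p (- X (snd z))) \<longlongrightarrow> 0) (sequentially \<times>\<^sub>F sequentially)"
    using filterlim_compose[OF assms[unfolded padic_vanishes_def] filterlim_fst]
      filterlim_compose[OF assms[unfolded padic_vanishes_def] filterlim_snd]
    by (simp_all add: rat_padic_abs_minus)
  from vanishing_add[OF this] show ?thesis
    unfolding padic_cauchy_filter case_prod_unfold by simp
qed

end


section \<open>The field of \<open>p\<close>-adic numbers\<close>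

text \<open>
  The prime \<open>p\<close> is \<open>CARD('p)\<close> for a type \<open>'p\<close> of class \<^class>\<open>prime_card\<close>; the field is the
  completion of the rationals with respect to the \<open>p\<close>-adic absolute value, i.e. Cauchy sequences
  modulo null sequences.
\<close>

definition padic_rel :: "'p::prime_card itself \<Rightarrow> (nat \<Rightarrow> rat) \<Rightarrow> (nat \<Rightarrow> rat) \<Rightarrow> bool" where
  "padic_rel _ X Y \<longleftrightarrow> padic_cauchy CARD('p) X \<and> padic_cauchy CARD('p) Y \<and>
     padic_vanishes CARD('p) (\<lambda>n. X n - Y n)"

lemma part_equivp_padic_rel: "part_equivp (padic_rel TYPE('p::prime_card))"
proof (rule part_equivpI)
  note pr = prime_card[where 'a = 'p]
  show "\<exists>X. padic_rel TYPE('p) X X"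
    by (rule exI[of _ "\<lambda>_. 0"]) (simp add: padic_rel_def padic_cauchy_def padic_vanishes_def)
  show "symp (padic_rel TYPE('p))"
    by (auto simp: symp_def padic_rel_def padic_vanishes_def rat_padic_abs_minus_commute[OF pr])
  show "transp (padic_rel TYPE('p))"
  proof (rule transpI)
    fix X Y Z assume "padic_rel TYPE('p) X Y" "padic_rel TYPE('p) Y Z"
    thus "padic_rel TYPE('p) X Z"
      using padic_vanishes_add[OF pr, of "\<lambda>n. X n - Y n" "\<lambda>n. Y n - Z n"]
      by (simp add: padic_rel_def)
  qed
qed

typedef (overloaded) ('p::prime_card) padic =
  "{c. \<exists>X. padic_rel TYPE('p) X X \<and> c = Collect (padic_rel TYPE('p) X)}"
  morphisms padic_class padic_of_class
  using part_equivp_padic_rel[where 'p = 'p] unfolding part_equivp_def by blast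

definition abs_padic :: "(nat \<Rightarrow> rat) \<Rightarrow> 'p::prime_card padic" where
  "abs_padic X = padic_of_class (Collect (padic_rel TYPE('p) X))"

definition rep_padic :: "'p::prime_card padic \<Rightarrow> nat \<Rightarrow> rat" where
  "rep_padic x = (SOME X. X \<in> padic_class x)"

definition cr_padic :: "(nat \<Rightarrow> rat) \<Rightarrow> 'p::prime_card padic \<Rightarrow> bool" where
  "cr_padic X x \<longleftrightarrow> padic_rel TYPE('p) X X \<and> abs_padic X = x"

lemma Quotient_padic:
  "Quotient (padic_rel TYPE('p::prime_card)) abs_padic rep_padic
     (cr_padic :: _ \<Rightarrow> 'p padic \<Rightarrow> bool)"
proof (rule Quotient3_to_Quotient)
  have "quot_type (padic_rel TYPE('p)) padic_of_class
      (padic_class :: 'p padic \<Rightarrow> _)"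
  proof unfold_locales
    show "part_equivp (padic_rel TYPE('p))" by (rule part_equivp_padic_rel)
    fix x y :: "'p padic"
    show "\<exists>X. padic_rel TYPE('p) X X \<and> padic_class x = Collect (padic_rel TYPE('p) X)"
      using padic_class[of x] by simp
    show "padic_of_class (padic_class x) = x" by (rule padic_class_inverse)
    show "padic_class x = padic_class y \<longleftrightarrow> x = y" by (rule padic_class_inject)
  next
    fix c assume "\<exists>X. padic_rel TYPE('p) X X \<and> c = Collect (padic_rel TYPE('p) X)"
    thus "padic_class (padic_of_class c :: 'p padic) = c"
      by (intro padic_of_class_inverse) simp
  qed
  from quot_type.Quotient[OF this]
  show "Quotient3 (padic_rel TYPE('p)) abs_padic (rep_padic :: 'p padic \<Rightarrow> _)"
    unfolding quot_type.abs_def[OF \<open>quot_type _ _ _\<close>] quot_type.rep_def[OF \<open>quot_type _ _ _\<close>]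
      abs_padic_def[abs_def] rep_padic_def[abs_def] .
  show "cr_padic \<equiv> \<lambda>X x :: 'p padic. padic_rel TYPE('p) X X \<and> abs_padic X = x"
    by (intro eq_reflection ext) (rule cr_padic_def)
qed

setup_lifting Quotient_padic

instantiation padic :: (prime_card) field
begin

lift_definition zero_padic :: "'a padic" is "\<lambda>_. 0"
  by (simp add: padic_rel_def padic_cauchy_def padic_vanishes_def)

lift_definition one_padic :: "'a padic" is "\<lambda>_. 1"
  by (simp add: padic_rel_def padic_cauchy_def padic_vanishes_def)

lift_definition plus_padic :: "'a padic \<Rightarrow> 'a padic \<Rightarrow> 'a padic" is "\<lambda>X Y n. X n + Y n"
proof -
  fix X X' Y Y'
  assume *: "padic_rel TYPE('a) X X'" "padic_rel TYPE('a) Y Y'"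
  have "padic_vanishes CARD('a) (\<lambda>n. (X n - X' n) + (Y n - Y' n))"
    using * by (intro padic_vanishes_add[OF prime_card]) (auto simp: padic_rel_def)
  moreover have "(\<lambda>n. (X n - X' n) + (Y n - Y' n)) = (\<lambda>n. X n + Y n - (X' n + Y' n))"
    by (simp add: algebra_simps)
  ultimately show "padic_rel TYPE('a) (\<lambda>n. X n + Y n) (\<lambda>n. X' n + Y' n)"
    using * by (auto simp: padic_rel_def intro!: padic_cauchy_add[OF prime_card])
qed

lift_definition uminus_padic :: "'a padic \<Rightarrow> 'a padic" is "\<lambda>X n. - X n"
proof -
  fix X X' assume *: "padic_rel TYPE('a) X X'"
  have "padic_vanishes CARD('a) (\<lambda>n. - (X n - X' n))"
    using * by (intro padic_vanishes_minus[OF prime_card]) (auto simp: padic_rel_def)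
  moreover have "(\<lambda>n. - (X n - X' n)) = (\<lambda>n. - X n - - X' n)" by simp
  ultimately show "padic_rel TYPE('a) (\<lambda>n. - X n) (\<lambda>n. - X' n)"
    using * by (auto simp: padic_rel_def intro!: padic_cauchy_minus[OF prime_card])
qed

lift_definition times_padic :: "'a padic \<Rightarrow> 'a padic \<Rightarrow> 'a padic" is "\<lambda>X Y n. X n * Y n"
proof -
  fix X X' Y Y'
  assume *: "padic_rel TYPE('a) X X'" "padic_rel TYPE('a) Y Y'"
  have "padic_vanishes CARD('a) (\<lambda>n. (X n - X' n) * Y n + (Y n - Y' n) * X' n)"
    using * by (intro padic_vanishes_add[OF prime_card] padic_vanishes_mult[OF prime_card])
      (auto simp: padic_rel_def)
  moreover have "(\<lambda>n. (X n - X' n) * Y n + (Y n - Y' n) * X' n) = (\<lambda>n. X n * Y n - X' n * Y' n)"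
    by (simp add: algebra_simps)
  ultimately show "padic_rel TYPE('a) (\<lambda>n. X n * Y n) (\<lambda>n. X' n * Y' n)"
    using * by (auto simp: padic_rel_def intro!: padic_cauchy_mult[OF prime_card])
qed

lift_definition inverse_padic :: "'a padic \<Rightarrow> 'a padic"
  is "\<lambda>X. if padic_vanishes CARD('a) X then (\<lambda>_. 0) else (\<lambda>n. inverse (X n))"
proof -
  fix X Y assume *: "padic_rel TYPE('a) X Y"
  note pr = prime_card[where 'a = 'a]
  have c: "padic_cauchy CARD('a) X" "padic_cauchy CARD('a) Y"
    and v: "padic_vanishes CARD('a) (\<lambda>n. X n - Y n)"
    using * by (auto simp: padic_rel_def)
  have iff: "padic_vanishes CARD('a) X \<longleftrightarrow> padic_vanishes CARD('a) Y"
    using padic_vanishes_add[OF pr v, of Y]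
      padic_vanishes_add[OF pr padic_vanishes_minus[OF pr v], of X] by auto
  show "padic_rel TYPE('a) (if padic_vanishes CARD('a) X then (\<lambda>_. 0) else (\<lambda>n. inverse (X n)))
          (if padic_vanishes CARD('a) Y then (\<lambda>_. 0) else (\<lambda>n. inverse (Y n)))"
  proof (cases "padic_vanishes CARD('a) X")
    case True
    thus ?thesis using iff by (simp add: padic_rel_def padic_cauchy_def padic_vanishes_def)
  next
    case False
    hence nv: "\<not> padic_vanishes CARD('a) X" "\<not> padic_vanishes CARD('a) Y" using iff by auto
    obtain a where a: "a > 0" "eventually (\<lambda>n. rat_padic_abs CARD('a) (X n) > a) sequentially"
      using padic_cauchy_not_vanishes[OF pr c(1) nv(1)] .
    obtain b where b: "b > 0" "eventually (\<lambda>n. rat_padic_abs CARD('a) (Y n) > b) sequentially"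
      using padic_cauchy_not_vanishes[OF pr c(2) nv(2)] .
    have "padic_vanishes CARD('a) (\<lambda>n. inverse (X n) - inverse (Y n))"
      using vanishing_inverse_diff[OF pr v[unfolded padic_vanishes_def] a(2) b(2) a(1) b(1)]
      by (simp add: padic_vanishes_def)
    thus ?thesis
      using nv padic_cauchy_inverse[OF pr c(1) nv(1)] padic_cauchy_inverse[OF pr c(2) nv(2)]
      by (simp add: padic_rel_def)
  qed
qed

definition minus_padic :: "'a padic \<Rightarrow> 'a padic \<Rightarrow> 'a padic" where
  "minus_padic x y = x + - y"

definition divide_padic :: "'a padic \<Rightarrow> 'a padic \<Rightarrow> 'a padic" where
  "divide_padic x y = x * inverse y"

instance
proof
  note pr = prime_card[where 'a = 'a]
  have rI: "padic_rel TYPE('a) X Y" if "padic_cauchy CARD('a) X" "X = Y" for X Y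
    using that by (simp add: padic_rel_def padic_vanishes_def)
  note cI = padic_cauchy_add[OF pr] padic_cauchy_mult[OF pr] padic_cauchy_minus[OF pr]
    padic_cauchy_const[OF pr]
  fix x y z :: "'a padic"
  show "x + y + z = x + (y + z)"
    by transfer (rule rI, auto simp: padic_rel_def algebra_simps intro!: cI)
  show "x + y = y + x"
    by transfer (rule rI, auto simp: padic_rel_def algebra_simps intro!: cI)
  show "0 + x = x"
    by transfer (rule rI, auto simp: padic_rel_def)
  show "- x + x = 0"
    by transfer (rule rI, auto simp: padic_rel_def intro!: cI)
  show "x - y = x + - y" by (rule minus_padic_def)
  show "x * y * z = x * (y * z)"
    by transfer (rule rI, auto simp: padic_rel_def algebra_simps intro!: cI)
  show "x * y = y * x"
    by transfer (rule rI, auto simp: padic_rel_def algebra_simps intro!: cI)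
  show "1 * x = x"
    by transfer (rule rI, auto simp: padic_rel_def)
  show "(x + y) * z = x * z + y * z"
    by transfer (rule rI, auto simp: padic_rel_def algebra_simps intro!: cI)
  show "(0 :: 'a padic) \<noteq> 1"
  proof
    assume "(0 :: 'a padic) = 1"
    hence "abs_padic (\<lambda>_. 0) = (abs_padic (\<lambda>_. 1) :: 'a padic)"
      by (simp only: zero_padic_def one_padic_def)
    moreover have "padic_rel TYPE('a) (\<lambda>_. 0) (\<lambda>_. 0)" "padic_rel TYPE('a) (\<lambda>_. 1) (\<lambda>_. 1)"
      by (auto intro!: rI cI)
    ultimately have "padic_rel TYPE('a) (\<lambda>_. 0) (\<lambda>_. 1)"
      using Quotient_rel[OF Quotient_padic[where 'p = 'a], of "\<lambda>_. 0" "\<lambda>_. 1"] by blast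
    thus False
      by (simp add: padic_rel_def padic_vanishes_def rat_padic_abs_minus[OF pr]
          rat_padic_abs_1[OF pr] LIMSEQ_const_iff)
  qed
  have "inverse (abs_padic X :: 'a padic) =
      abs_padic (if padic_vanishes CARD('a) X then (\<lambda>_. 0) else (\<lambda>n. inverse (X n)))"
    if "padic_rel TYPE('a) X X" for X
    using that by (rule inverse_padic.abs_eq)
  from this[of "\<lambda>_. 0"]
  have "inverse (abs_padic (\<lambda>_. 0)) = (abs_padic (\<lambda>_. 0) :: 'a padic)"
    by (simp add: rI cI padic_vanishes_def)
  thus "inverse (0 :: 'a padic) = 0" by (simp add: zero_padic_def)
  show "x div y = x * inverse y" by (rule divide_padic_def)
  show "inverse x * x = 1" if "x \<noteq> 0"
    using that
  proof transfer
    fix X assume X: "padic_rel TYPE('a) X X" and nz: "\<not> padic_rel TYPE('a) X (\<lambda>_. 0)"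
    have c: "padic_cauchy CARD('a) X" using X by (simp add: padic_rel_def)
    have nv: "\<not> padic_vanishes CARD('a) X"
      using nz c by (simp add: padic_rel_def cI)
    obtain a where a: "a > 0" "eventually (\<lambda>n. rat_padic_abs CARD('a) (X n) > a) sequentially"
      using padic_cauchy_not_vanishes[OF pr c nv] .
    have "eventually (\<lambda>n. 0 = rat_padic_abs CARD('a) (inverse (X n) * X n - 1)) sequentially"
      using a(2)
    proof eventually_elim
      case (elim n)
      hence "X n \<noteq> 0" using a(1) by auto
      thus ?case by simp
    qed
    hence "padic_vanishes CARD('a) (\<lambda>n. inverse (X n) * X n - 1)"
      unfolding padic_vanishes_def by (rule Lim_transform_eventually[OF tendsto_const])
    thus "padic_rel TYPE('a) (\<lambda>n. (if padic_vanishes CARD('a) X then (\<lambda>_. 0)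
            else (\<lambda>n. inverse (X n))) n * X n) (\<lambda>_. 1)"
      using nv c padic_cauchy_inverse[OF pr c nv] by (auto simp: padic_rel_def intro!: cI)
  qed
qed

end

lift_definition padic_norm :: "'p::prime_card padic \<Rightarrow> real"
  is "\<lambda>X. lim (\<lambda>n. rat_padic_abs CARD('p) (X n))"
proof -
  fix X Y assume *: "padic_rel TYPE('p) X Y"
  note pr = prime_card[where 'a = 'p]
  let ?v = "rat_padic_abs CARD('p)"
  have "(\<lambda>n. ?v (X n - Y n)) \<longlonglongrightarrow> 0"
    using * by (simp add: padic_rel_def padic_vanishes_def)
  hence "(\<lambda>n. ?v (X n) - ?v (Y n)) \<longlonglongrightarrow> 0"
    by (rule Lim_null_comparison[rotated]) (simp add: rat_padic_abs_triangle_rev[OF pr])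
  moreover obtain L where L: "(\<lambda>n. ?v (Y n)) \<longlonglongrightarrow> L"
    using * padic_cauchy_imp_convergent_abs[OF pr, of Y]
    by (auto simp: padic_rel_def convergent_def)
  ultimately have "(\<lambda>n. ?v (X n) - ?v (Y n) + ?v (Y n)) \<longlonglongrightarrow> 0 + L"
    by (rule tendsto_add)
  thus "lim (\<lambda>n. ?v (X n)) = lim (\<lambda>n. ?v (Y n))"
    using L by (simp add: limI)
qed

lemma rat_padic_abs_tendsto_lim:
  assumes "padic_rel TYPE('p::prime_card) X Y"
  shows "(\<lambda>n. rat_padic_abs CARD('p) (X n)) \<longlonglongrightarrow> lim (\<lambda>n. rat_padic_abs CARD('p) (X n))"
  using assms padic_cauchy_imp_convergent_abs[OF prime_card[where 'a = 'p]]
  by (auto simp: padic_rel_def convergent_LIMSEQ_iff)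

lemma padic_norm_eq_0_iff: "padic_norm x = 0 \<longleftrightarrow> x = 0" for x :: "'p::prime_card padic"
proof transfer
  fix X assume X: "padic_rel TYPE('p) X X"
  let ?v = "rat_padic_abs CARD('p)"
  have "lim (\<lambda>n. ?v (X n)) = 0 \<longleftrightarrow> (\<lambda>n. ?v (X n)) \<longlonglongrightarrow> 0"
    using rat_padic_abs_tendsto_lim[OF X] limI[of "\<lambda>n. ?v (X n)" 0] by metis
  thus "lim (\<lambda>n. ?v (X n)) = 0 \<longleftrightarrow> padic_rel TYPE('p) X (\<lambda>_. 0)"
    using X by (simp add: padic_rel_def padic_vanishes_def padic_cauchy_def)
qed

lemma padic_norm_nonneg: "padic_norm x \<ge> 0" for x :: "'p::prime_card padic"
proof transfer
  fix X assume X: "padic_rel TYPE('p) X X"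
  show "lim (\<lambda>n. rat_padic_abs CARD('p) (X n)) \<ge> 0"
    by (rule LIMSEQ_le_const[OF rat_padic_abs_tendsto_lim[OF X]])
      (auto simp: rat_padic_abs_nonneg[OF prime_card])
qed

lemma padic_norm_mult: "padic_norm (x * y) = padic_norm x * padic_norm y"
  for x y :: "'p::prime_card padic"
proof transfer
  fix X Y assume X: "padic_rel TYPE('p) X X" and Y: "padic_rel TYPE('p) Y Y"
  show "lim (\<lambda>n. rat_padic_abs CARD('p) (X n * Y n)) =
      lim (\<lambda>n. rat_padic_abs CARD('p) (X n)) * lim (\<lambda>n. rat_padic_abs CARD('p) (Y n))"
    using tendsto_mult[OF rat_padic_abs_tendsto_lim[OF X] rat_padic_abs_tendsto_lim[OF Y]]
    by (simp add: rat_padic_abs_mult[OF prime_card] limI)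
qed

lemma padic_norm_minus: "padic_norm (- x) = padic_norm x" for x :: "'p::prime_card padic"
  by transfer (simp add: rat_padic_abs_minus[OF prime_card])

lemma padic_norm_add_le_max: "padic_norm (x + y) \<le> max (padic_norm x) (padic_norm y)"
  for x y :: "'p::prime_card padic"
proof transfer
  fix X Y assume X: "padic_rel TYPE('p) X X" and Y: "padic_rel TYPE('p) Y Y"
  let ?v = "rat_padic_abs CARD('p)"
  have "padic_rel TYPE('p) (\<lambda>n. X n + Y n) (\<lambda>n. X n + Y n)"
    using X Y by (auto simp: padic_rel_def padic_vanishes_def intro!: padic_cauchy_add[OF prime_card])
  note lim = rat_padic_abs_tendsto_lim[OF this]
  show "lim (\<lambda>n. ?v (X n + Y n)) \<le> max (lim (\<lambda>n. ?v (X n))) (lim (\<lambda>n. ?v (Y n)))"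
    by (rule LIMSEQ_le[OF lim tendsto_max[OF rat_padic_abs_tendsto_lim[OF X] rat_padic_abs_tendsto_lim[OF Y]]])
      (auto simp: rat_padic_abs_add_le_max[OF prime_card])
qed

instantiation padic :: (prime_card) metric_space
begin

definition dist_padic :: "'a padic \<Rightarrow> 'a padic \<Rightarrow> real" where
  "dist_padic x y = padic_norm (x - y)"

definition uniformity_padic :: "('a padic \<times> 'a padic) filter" where
  "uniformity_padic = (INF e\<in>{0<..}. principal {(x, y). dist x y < e})"

definition open_padic :: "'a padic set \<Rightarrow> bool" where
  "open_padic U \<longleftrightarrow> (\<forall>x\<in>U. eventually (\<lambda>(x', y). x' = x \<longrightarrow> y \<in> U) uniformity)"

instance
proof
  show "uniformity = (INF e\<in>{0<..}. principal {(x, y :: 'a padic). dist x y < e})"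
    by (rule uniformity_padic_def)
  fix U :: "'a padic set"
  show "open U \<longleftrightarrow> (\<forall>x\<in>U. eventually (\<lambda>(x', y). x' = x \<longrightarrow> y \<in> U) uniformity)"
    by (rule open_padic_def)
next
  fix x y z :: "'a padic"
  show "dist x y = 0 \<longleftrightarrow> x = y" by (simp add: dist_padic_def padic_norm_eq_0_iff)
  show "dist x y \<le> dist x z + dist y z"
    using padic_norm_add_le_max[of "x - z" "- (y - z)"] padic_norm_minus[of "y - z"]
      padic_norm_nonneg[of "x - z"] padic_norm_nonneg[of "y - z"]
    by (simp add: dist_padic_def)
qed

end

lemma of_nat_padic: "(of_nat k :: 'p::prime_card padic) = abs_padic (\<lambda>_. of_nat k)"
proof (induction k)
  case 0
  show ?case by (simp add: zero_padic_def)
next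
  case (Suc k)
  have rel: "padic_rel TYPE('p) (\<lambda>_. c) (\<lambda>_. c)" for c
    by (simp add: padic_rel_def padic_cauchy_def padic_vanishes_def)
  have "abs_padic (\<lambda>_. a) + (abs_padic (\<lambda>_. b) :: 'p padic) = abs_padic (\<lambda>_. a + b)" for a b
    by (rule plus_padic.abs_eq[OF rel rel])
  thus ?case by (simp add: Suc.IH one_padic_def)
qed

lemma padic_norm_of_nat:
  "padic_norm (of_nat k :: 'p::prime_card padic) = rat_padic_abs CARD('p) (of_nat k)"
proof -
  have "padic_rel TYPE('p) (\<lambda>_. of_nat k) (\<lambda>_. of_nat k)"
    by (simp add: padic_rel_def padic_cauchy_def padic_vanishes_def)
  hence "padic_norm (abs_padic (\<lambda>_. of_nat k) :: 'p padic) =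
      lim (\<lambda>_. rat_padic_abs CARD('p) (of_nat k))"
    by (rule padic_norm.abs_eq)
  thus ?thesis by (simp add: of_nat_padic)
qed

lemma padic_norm_of_nat_p: "padic_norm (of_nat CARD('p) :: 'p::prime_card padic) = 1 / real CARD('p)"
  using rat_padic_abs_divide[OF prime_card[where 'a = 'p], of "int CARD('p)" 1]
    prime_gt_0_nat[OF prime_card[where 'a = 'p]] prime_card_int[where 'a = 'p]
  by (simp add: padic_norm_of_nat power_int_minus inverse_eq_divide)

definition padic_ints :: "'p::prime_card padic set" where
  "padic_ints = {x. padic_norm x \<le> 1}"

definition padic_int_vecs :: "('p::prime_card padic ^ 'n) set" where
  "padic_int_vecs = {x. \<forall>i. x $ i \<in> padic_ints}"


section \<open>Van der Put expansions and Lipschitz functions\<close>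

definition padic_digits :: "'p::prime_card padic \<Rightarrow> (nat \<Rightarrow> nat) \<Rightarrow> bool" where
  "padic_digits x d \<longleftrightarrow>
     (\<forall>i. d i < CARD('p)) \<and> (\<lambda>i. of_nat (d i) * of_nat CARD('p) ^ i) sums x"

definition vdp_e :: "nat \<Rightarrow> 'p::prime_card padic \<Rightarrow> 'p padic" where
  "vdp_e m x =
     (if \<exists>d N. padic_digits x d \<and> m = (\<Sum>i\<le>N. d i * CARD('p) ^ i) then 1 else 0)"

definition vdp_E :: "nat ^ 'n \<Rightarrow> 'p::prime_card padic ^ 'n \<Rightarrow> 'p padic" where
  "vdp_E m x = (\<Prod>i\<in>UNIV. vdp_e (m $ i) (x $ i))"

text \<open>Uniform convergence of the multi-indexed series is along its finite partial sums.\<close>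

definition vdp_expansion ::
    "('p::prime_card padic ^ 'n \<Rightarrow> 'p padic) \<Rightarrow> (nat ^ 'n \<Rightarrow> 'p padic) \<Rightarrow> bool" where
  "vdp_expansion F A \<longleftrightarrow>
     uniform_limit padic_int_vecs (\<lambda>S x. \<Sum>m\<in>S. A m * vdp_E m x) F (finite_subsets_at_top UNIV)"

definition padic_lipschitz :: "nat ^ 'n \<Rightarrow> ('p::prime_card padic ^ 'n \<Rightarrow> 'p padic) \<Rightarrow> bool" where
  "padic_lipschitz \<alpha> F \<longleftrightarrow>
     (\<forall>x\<in>padic_int_vecs. \<forall>y\<in>padic_int_vecs.
        padic_norm (F x - F y) \<le> (MAX i. real CARD('p) ^ (\<alpha> $ i) * padic_norm (x $ i - y $ i)))"

end

theory Submission
  imports Defs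
begin

text \<open>
  On vectors of natural numbers every van der Put function is the indicator of digit prefixes.
  Replacing \<open>m\<^sub>i\<close> by its truncation without the leading digit loses exactly the prefix \<open>m\<^sub>i\<close>, so the
  alternating sum of \<open>F\<close> over all ways of truncating coordinates in \<open>I(m)\<close> recovers the
  coefficient \<open>A\<^sub>m\<close>. For a fixed \<open>i \<in> I(m)\<close>, pair the terms that differ only in the truncation of
  the \<open>i\<close>-th coordinate: the Lipschitz condition bounds each pair, and the ultrametric inequality
  bounds their sum.
\<close>

section \<open>Norms and digits of natural numbers\<close>

text \<open>The ultrametric inequality keeps the bound independent of the number of terms;
  \<open>B >= 0\<close> covers empty and infinite \<open>S\<close>, where \<open>sum\<close> is
  0.\<close>

lemma padic_norm_sum_le:
  fixes f :: "'b \<Rightarrow> 'p::prime_card padic"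
  assumes "\<And>x. x \<in> S \<Longrightarrow> padic_norm (f x) \<le> B" "B \<ge> 0"
  shows "padic_norm (sum f S) \<le> B"
  using assms(1)
proof (induction S rule: infinite_finite_induct)
  case (insert x S)
  then show ?case
    using padic_norm_add_le_max[of "f x" "sum f S"] by fastforce
qed (use assms(2) in \<open>simp_all add: padic_norm_eq_0_iff[THEN iffD2]\<close>)

lemma padic_norm_power: "padic_norm (x ^ k) = padic_norm x ^ k"
  for x :: "'p::prime_card padic"
proof (induction k)
  case 0
  show ?case
    using padic_norm_of_nat[of 1, where 'p = 'p] rat_padic_abs_1[OF prime_card[where 'a = 'p]] by simp
qed (simp add: padic_norm_mult)

lemma padic_norm_minus_one_power_mult: "padic_norm ((- 1) ^ k * x) = padic_norm x"
  for x :: "'p::prime_card padic"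
  by (cases "even k") (simp_all add: padic_norm_minus)

lemma padic_norm_of_nat_le_1: "padic_norm (of_nat k :: 'p::prime_card padic) \<le> 1"
  using rat_padic_abs_of_int_le[OF prime_card[where 'a = 'p], of "int k"]
  by (simp add: padic_norm_of_nat)

lemma padic_norm_p_power_mult_le:
  "padic_norm (of_nat (CARD('p) ^ N * t) :: 'p::prime_card padic) \<le> (1 / real CARD('p)) ^ N"
  using mult_left_mono[OF padic_norm_of_nat_le_1[of t, where 'p = 'p], of "(1 / real CARD('p)) ^ N"]
  by (simp add: padic_norm_mult padic_norm_power padic_norm_of_nat_p)

text \<open>For nonzero \<open>k\<close> the norm is p to the minus multiplicity, so a small norm
  forces a large multiplicity. This turns p-adic closeness into congruences.\<close>

lemma dvd_if_padic_norm_of_nat_le: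
  assumes "padic_norm (of_nat k :: 'p::prime_card padic) \<le> (1 / real CARD('p)) ^ N"
  shows "CARD('p) ^ N dvd k"
proof (cases "k = 0")
  case False
  note pr = prime_card[where 'a = 'p]
  have p1: "real CARD('p) > 1" using p_gt_1[OF pr] .
  let ?v = "multiplicity (int CARD('p)) (int k)"
  have "real CARD('p) powi (- int ?v) \<le> (1 / real CARD('p)) ^ N"
    using assms rat_padic_abs_divide[OF pr, of "int k" 1] False by (simp add: padic_norm_of_nat)
  also have "\<dots> = real CARD('p) powi (- int N)"
    by (simp add: power_int_minus power_one_over inverse_eq_divide)
  finally have "real CARD('p) powi (- int ?v) \<le> real CARD('p) powi (- int N)" .
  hence "N \<le> ?v"
    using power_int_strict_increasing[of "- int N" "- int ?v", OF _ p1] by linarith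
  hence "int CARD('p) ^ N dvd int k" by (rule multiplicity_dvd')
  thus ?thesis by (metis of_nat_dvd_iff of_nat_power)
qed auto

lemma mod_eq_if_padic_norm_diff_le:
  assumes "padic_norm (of_nat a - of_nat b :: 'p::prime_card padic) \<le> (1 / real CARD('p)) ^ N"
  shows "a mod CARD('p) ^ N = b mod CARD('p) ^ N"
proof -
  \<comment> \<open>Subtraction on naturals truncates, so the divisibility argument needs
    \<open>b <= a\<close>; the other case follows by symmetry of the norm.\<close>
  have *: "a mod CARD('p) ^ N = b mod CARD('p) ^ N"
    if "b \<le> a" "padic_norm (of_nat a - of_nat b :: 'p padic) \<le> (1 / real CARD('p)) ^ N" for a b
  proof -
    have "CARD('p) ^ N dvd a - b"
      by (rule dvd_if_padic_norm_of_nat_le) (use that in \<open>simp add: of_nat_diff\<close>)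
    thus ?thesis using that(1) by (metis mod_eq_dvd_iff_nat)
  qed
  show ?thesis
  proof (cases "b \<le> a")
    case True
    thus ?thesis using * assms by blast
  next
    case False
    have "padic_norm (of_nat b - of_nat a :: 'p padic) \<le> (1 / real CARD('p)) ^ N"
      using assms padic_norm_minus[of "of_nat a - of_nat b :: 'p padic"] by simp
    thus ?thesis using *[of a b] False by simp
  qed
qed

section \<open>Base-p digits of natural numbers\<close>

lemma digit_sum_less:
  fixes b :: nat
  assumes "\<And>i. d i < b"
  shows "(\<Sum>i<N. d i * b ^ i) < b ^ N"
proof (induction N)
  case (Suc N)
  have "(d N + 1) * b ^ N \<le> b * b ^ N"
    using assms[of N] by (intro mult_right_mono) auto
  with Suc show ?case by (simp add: algebra_simps)
qed simp

lemma digit_sum_eq_mod: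
  fixes b :: nat
  shows "(\<Sum>i<N. (k div b ^ i mod b) * b ^ i) = k mod b ^ N"
proof (induction N)
  case (Suc N)
  then show ?case
    by (simp add: mod_mult2_eq mult.commute[of b])
qed simp

text \<open>The digits are forced: a late partial sum is congruent to \<open>k\<close> modulo p^N,
  its terms from index N on vanish modulo p^N, and the first N terms add up to less than
  p^N.\<close>

lemma digit_sum_of_padic_digits:
  assumes "padic_digits (of_nat k :: 'p::prime_card padic) d"
  shows "(\<Sum>i<N. d i * CARD('p) ^ i) = k mod CARD('p) ^ N"
proof -
  define s where "s M = (\<Sum>i<M. d i * CARD('p) ^ i)" for M
  have p0: "real CARD('p) > 0"
    using p_gt_1[OF prime_card[where 'a = 'p]] by linarith
  have d: "d i < CARD('p)" for i
    using assms by (simp add: padic_digits_def)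
  have "(\<lambda>M. of_nat (s M)) \<longlonglongrightarrow> (of_nat k :: 'p padic)"
    using assms by (simp add: padic_digits_def sums_def s_def)
  then obtain M0 where M0: "\<And>M. M \<ge> M0 \<Longrightarrow> dist (of_nat (s M)) (of_nat k :: 'p padic) < (1 / real CARD('p)) ^ N"
    using p0 unfolding lim_sequentially by (meson zero_less_divide_1_iff zero_less_power)
  \<comment> \<open>Late enough to be close to \<open>k\<close>, and long enough to contain the
    first \<open>N\<close> terms.\<close>
  define M where "M = N + M0"
  have "s M = s N + (\<Sum>i=N..<M. d i * CARD('p) ^ i)"
    unfolding s_def M_def
    by (metis le_add1 lessThan_atLeast0 sum.atLeastLessThan_concat zero_le)
  moreover have "CARD('p) ^ N dvd (\<Sum>i=N..<M. d i * CARD('p) ^ i)"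
    by (intro dvd_sum dvd_mult le_imp_power_dvd) auto
  ultimately obtain t where t: "s M = s N + CARD('p) ^ N * t" by (auto elim: dvdE)
  have "s M mod CARD('p) ^ N = k mod CARD('p) ^ N"
    by (rule mod_eq_if_padic_norm_diff_le)
      (use M0[of M] in \<open>simp add: M_def dist_padic_def\<close>)
  hence "s N mod CARD('p) ^ N = k mod CARD('p) ^ N" using t by simp
  thus ?thesis using digit_sum_less[of d "CARD('p)" N] d by (simp add: s_def)
qed

lemma padic_digits_of_nat:
  "padic_digits (of_nat k :: 'p::prime_card padic) (\<lambda>i. k div CARD('p) ^ i mod CARD('p))"
proof -
  have p: "CARD('p) > 1" using prime_gt_1_nat[OF prime_card[where 'a = 'p]] .
  let ?f = "\<lambda>i. of_nat (k div CARD('p) ^ i mod CARD('p)) * (of_nat CARD('p) ^ i :: 'p padic)"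
  \<comment> \<open>Since i < p^i, all digits from position \<open>k\<close> on are zero, so the
    series is a finite sum.\<close>
  have lt: "k < CARD('p) ^ i" if "k \<le> i" for i
    using that power_gt_expt[of "CARD('p)" i] p by linarith
  have "?f sums (\<Sum>i<k. ?f i)"
    by (intro sums_finite) (use lt in auto)
  also have "(\<Sum>i<k. ?f i) = of_nat (\<Sum>i<k. (k div CARD('p) ^ i mod CARD('p)) * CARD('p) ^ i)"
    by simp
  also have "\<dots> = of_nat k"
    unfolding digit_sum_eq_mod using lt[of k] by simp
  finally show ?thesis
    using p by (simp add: padic_digits_def)
qed

section \<open>Van der Put functions at natural numbers\<close>

lemma vdp_e_of_nat:
  "vdp_e m (of_nat k :: 'p::prime_card padic) = (if \<exists>N. m = k mod CARD('p) ^ Suc N then 1 else 0)"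
proof -
  \<comment> \<open>Existence and uniqueness of the digits remove the quantifier over
    \<open>d\<close>; a prefix ending at position N has N + 1 digits, hence
    \<open>Suc N\<close>.\<close>
  have "(\<exists>d N. padic_digits (of_nat k :: 'p padic) d \<and> m = (\<Sum>i\<le>N. d i * CARD('p) ^ i)) \<longleftrightarrow>
      (\<exists>N. m = k mod CARD('p) ^ Suc N)"
    using digit_sum_of_padic_digits[where 'p = 'p and k = k] padic_digits_of_nat[of k, where 'p = 'p]
    unfolding lessThan_Suc_atMost[symmetric] by metis
  thus ?thesis by (simp only: vdp_e_def)
qed

text \<open>A single-digit number has no prefix but itself, so coordinates outside I(m) yield an
  indicator without truncation.\<close>

lemma vdp_e_of_nat_less_p:
  assumes "k < CARD('p::prime_card)"
  shows "vdp_e m (of_nat k :: 'p padic) = of_bool (m = k)"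
proof -
  have "k mod CARD('p) ^ Suc N = k" for N
    using assms self_le_power[of "CARD('p)" "Suc N"] by (intro mod_less) linarith
  thus ?thesis by (simp add: vdp_e_of_nat del: power_Suc)
qed

text \<open>The number \<open>k mod p ^ r\<close> arises from \<open>k\<close> by removing the leading digit.\<close>

lemma vdp_e_of_nat_leading_digit:
  assumes r: "r > 0" "CARD('p::prime_card) ^ r \<le> k" "k < CARD('p) ^ Suc r"
  shows "vdp_e m (of_nat k :: 'p padic) - vdp_e m (of_nat (k mod CARD('p) ^ r)) = of_bool (m = k)"
proof -
  let ?p = "CARD('p)"
  have p: "?p > 1" using prime_gt_1_nat[OF prime_card[where 'a = 'p]] .
  have small: "k mod ?p ^ r mod ?p ^ Suc N = k mod ?p ^ Suc N" if "N < r" for N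
    using that by (intro mod_mod_cancel le_imp_power_dvd) simp
  have same: "k mod ?p ^ r mod ?p ^ Suc N = k mod ?p ^ r" if "r \<le> N" for N
  proof (rule mod_less)
    have "k mod ?p ^ r < ?p ^ r" using p by simp
    also have "\<dots> \<le> ?p ^ Suc N" using that p by (intro power_increasing) auto
    finally show "k mod ?p ^ r < ?p ^ Suc N" .
  qed
  have full: "k mod ?p ^ Suc N = k" if "r \<le> N" for N
  proof (rule mod_less)
    have "?p ^ Suc r \<le> ?p ^ Suc N" using that p by (intro power_increasing) auto
    thus "k < ?p ^ Suc N" using r by linarith
  qed
  have lt: "k mod ?p ^ M < k" if "M \<le> r" for M
  proof -
    have "k mod ?p ^ M < ?p ^ M" using p by simp
    also have "\<dots> \<le> ?p ^ r" using that p by (intro power_increasing) auto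
    finally show ?thesis using r by linarith
  qed
  \<comment> \<open>Truncation leaves exactly the prefixes of \<open>k\<close> with at most r
    digits.\<close>
  have "(\<exists>N. m = k mod ?p ^ r mod ?p ^ Suc N) \<longleftrightarrow> (\<exists>N<r. m = k mod ?p ^ Suc N)" (is "?L \<longleftrightarrow> ?R")
  proof
    assume ?L
    then obtain N where N: "m = k mod ?p ^ r mod ?p ^ Suc N" by blast
    show ?R
    proof (cases "N < r")
      case True
      thus ?thesis using N small by metis
    next
      case False
      \<comment> \<open>The whole truncated number is the prefix ending at position r - 1, which
        exists because \<open>r > 0\<close>.\<close>
      hence "m = k mod ?p ^ Suc (r - 1)" using N same[of N] r by simp
      thus ?thesis using r by (metis diff_less zero_less_one)
    qed
  next
    assume ?R
    thus ?L using small by metis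
  qed
  moreover have "(\<exists>N. m = k mod ?p ^ Suc N) \<longleftrightarrow> (\<exists>N<r. m = k mod ?p ^ Suc N) \<or> m = k"
    using full by (metis le_refl not_le)
  \<comment> \<open>Prefixes with at most r digits are below p^r <= k, so \<open>k\<close> itself is
    the one prefix that is lost.\<close>
  moreover have "\<not> (\<exists>N<r. k = k mod ?p ^ Suc N)"
    using lt by (metis Suc_leI less_irrefl)
  ultimately show ?thesis
    unfolding vdp_e_of_nat by auto
qed

section \<open>The coefficients as alternating sums\<close>

text \<open>Matches each subset avoiding \<open>j\<close> with the one that gains \<open>j\<close>;
  this is the pairing for the Lipschitz bound.\<close>

lemma sum_Pow_insert:
  fixes g :: "'i set \<Rightarrow> 'a::comm_monoid_add"
  assumes "finite I" "j \<notin> I"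
  shows "(\<Sum>T\<in>Pow (insert j I). g T) = (\<Sum>T\<in>Pow I. g T + g (insert j T))"
proof -
  have "inj_on (insert j) (Pow I)"
    using assms(2) by (intro inj_onI) (metis PowD insert_ident subsetD)
  moreover have "Pow I \<inter> insert j ` Pow I = {}" using assms(2) by auto
  ultimately show ?thesis
    using assms(1) by (simp add: Pow_insert sum.union_disjoint sum.reindex sum.distrib)
qed

text \<open>Expand the product of \<open>a i - b i\<close> over \<open>I\<close>: \<open>T\<close>
  records the factors contributing \<open>- b i\<close>, and the factors outside \<open>I\<close>
  are common to all terms.\<close>

lemma sum_Pow_alternating_prod:
  fixes a b :: "'i::finite \<Rightarrow> 'a::comm_ring_1"
  shows "(\<Sum>T\<in>Pow I. (- 1) ^ card T * (\<Prod>i\<in>UNIV. if i \<in> T then b i else a i)) =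
    (\<Prod>i\<in>UNIV. if i \<in> I then a i - b i else a i)"
proof -
  have "(\<Prod>i\<in>UNIV. if i \<in> T then b i else a i) = prod b T * prod a (I - T) * prod a (- I)"
    if "T \<in> Pow I" for T
  proof -
    have "- T = (I - T) \<union> - I" using that by auto
    moreover have "prod a ((I - T) \<union> - I) = prod a (I - T) * prod a (- I)"
      by (intro prod.union_disjoint) auto
    ultimately show ?thesis by (simp add: prod.If_cases Compl_eq_Diff_UNIV[symmetric] mult.assoc)
  qed
  hence "(\<Sum>T\<in>Pow I. (- 1) ^ card T * (\<Prod>i\<in>UNIV. if i \<in> T then b i else a i)) =
      (\<Sum>T\<in>Pow I. (- 1) ^ card T * prod b T * prod a (I - T)) * prod a (- I)"
    by (simp add: sum_distrib_right mult.assoc)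
  also have "\<dots> = (\<Prod>i\<in>I. a i - b i) * prod a (- I)"
    by (simp add: prod_diff_conv_sum)
  finally show ?thesis by (simp add: prod.If_cases)
qed

text \<open>In use, \<open>r i\<close> is the position of the leading digit of \<open>m $ i\<close>,
  and \<open>T\<close> is the set of coordinates that lose it.\<close>

definition trunc_vec :: "('n \<Rightarrow> nat) \<Rightarrow> nat ^ 'n \<Rightarrow> 'n set \<Rightarrow> 'p::prime_card padic ^ 'n" where
  "trunc_vec r m T = (\<chi> i. if i \<in> T then of_nat (m $ i mod CARD('p) ^ r i) else of_nat (m $ i))"

lemma trunc_vec_in_padic_int_vecs: "(trunc_vec r m T :: 'p::prime_card padic ^ 'n) \<in> padic_int_vecs"
  by (simp add: trunc_vec_def padic_int_vecs_def padic_ints_def padic_norm_of_nat_le_1)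

text \<open>As \<open>vdp_E\<close> is a product over coordinates, the alternating sum factors. Each
  factor is an indicator: inside I(m) by deleting the leading digit, outside because there is only
  one digit.\<close>

lemma alternating_sum_vdp_E:
  fixes m m' :: "nat ^ 'n"
  assumes "\<And>i. CARD('p::prime_card) \<le> m $ i \<Longrightarrow>
    r i > 0 \<and> CARD('p) ^ r i \<le> m $ i \<and> m $ i < CARD('p) ^ Suc (r i)"
  shows "(\<Sum>T\<in>Pow {i. CARD('p) \<le> m $ i}. (- 1) ^ card T * vdp_E m' (trunc_vec r m T :: 'p padic ^ 'n)) =
    of_bool (m' = m)"
proof -
  let ?e = "\<lambda>i k. vdp_e (m' $ i) (of_nat k :: 'p padic)"
  have E: "vdp_E m' (trunc_vec r m T :: 'p padic ^ 'n) =
      (\<Prod>i\<in>UNIV. if i \<in> T then ?e i (m $ i mod CARD('p) ^ r i) else ?e i (m $ i))" for T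
    unfolding vdp_E_def trunc_vec_def by (intro prod.cong) auto
  have "(if i \<in> {i. CARD('p) \<le> m $ i} then ?e i (m $ i) - ?e i (m $ i mod CARD('p) ^ r i) else ?e i (m $ i)) =
      of_bool (m' $ i = m $ i)" for i
    using assms[of i] vdp_e_of_nat_leading_digit[of "r i" "m $ i" "m' $ i", where 'p = 'p]
      vdp_e_of_nat_less_p[of "m $ i" "m' $ i", where 'p = 'p] by auto
  hence "(\<Sum>T\<in>Pow {i. CARD('p) \<le> m $ i}. (- 1) ^ card T * vdp_E m' (trunc_vec r m T :: 'p padic ^ 'n)) =
      (\<Prod>i\<in>UNIV. of_bool (m' $ i = m $ i))"
    unfolding E sum_Pow_alternating_prod by (simp only:)
  also have "\<dots> = of_bool (m' = m)"
    by (auto simp: vec_eq_iff prod_zero_iff)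
  finally show ?thesis .
qed

section \<open>The Lipschitz bound for alternating sums\<close>

lemma padic_lipschitz_single_coordinate:
  fixes F :: "'p::prime_card padic ^ 'n \<Rightarrow> 'p padic"
  assumes "padic_lipschitz \<alpha> F" "x \<in> padic_int_vecs" "y \<in> padic_int_vecs"
    and "\<And>j. j \<noteq> i \<Longrightarrow> x $ j = y $ j"
  shows "padic_norm (F x - F y) \<le> real CARD('p) ^ (\<alpha> $ i) * padic_norm (x $ i - y $ i)"
proof -
  have "padic_norm (F x - F y) \<le> (MAX j. real CARD('p) ^ (\<alpha> $ j) * padic_norm (x $ j - y $ j))"
    using assms(1-3) by (simp add: padic_lipschitz_def)
  also have "\<dots> \<le> real CARD('p) ^ (\<alpha> $ i) * padic_norm (x $ i - y $ i)"
  \<comment> \<open>The entries for j other than i are zero, hence below the nonnegative i-th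
    entry.\<close>
  proof (rule Max.boundedI)
    fix z assume "z \<in> range (\<lambda>j. real CARD('p) ^ (\<alpha> $ j) * padic_norm (x $ j - y $ j))"
    then obtain j where z: "z = real CARD('p) ^ (\<alpha> $ j) * padic_norm (x $ j - y $ j)" by blast
    show "z \<le> real CARD('p) ^ (\<alpha> $ i) * padic_norm (x $ i - y $ i)"
      using z assms(4)[of j] by (cases "j = i") (simp_all add: padic_norm_eq_0_iff[THEN iffD2] padic_norm_nonneg)
  qed auto
  finally show ?thesis .
qed

lemma alternating_sum_lipschitz_le:
  fixes F :: "'p::prime_card padic ^ 'n \<Rightarrow> 'p padic"
  assumes "padic_lipschitz \<alpha> F" "i \<in> I"
  shows "padic_norm (\<Sum>T\<in>Pow I. (- 1) ^ card T * F (trunc_vec r m T)) \<le>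
    real CARD('p) powi (- int (r i) + int (\<alpha> $ i))"
proof -
  let ?B = "real CARD('p) powi (- int (r i) + int (\<alpha> $ i))"
  let ?v = "trunc_vec r m :: _ \<Rightarrow> 'p padic ^ 'n"
  have p0: "real CARD('p) > 0"
    using p_gt_1[OF prime_card[where 'a = 'p]] by linarith
  define J where "J = I - {i}"
  have I: "I = insert i J" and J: "i \<notin> J" using assms(2) by (auto simp: J_def)
  have "padic_norm ((- 1) ^ card T * F (?v T) + (- 1) ^ card (insert i T) * F (?v (insert i T))) \<le> ?B"
    if "T \<in> Pow J" for T
  proof -
    have i: "i \<notin> T" using that J by auto
    \<comment> \<open>Adding \<open>i\<close> flips the parity of the cardinality, so the pair is a
      signed difference of values at points differing at most in coordinate
      \<open>i\<close>.\<close>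
    have "(- 1) ^ card T * F (?v T) + (- 1) ^ card (insert i T) * F (?v (insert i T)) =
        (- 1) ^ card T * (F (?v T) - F (?v (insert i T)))"
      using i by (simp add: algebra_simps)
    moreover have "padic_norm (F (?v T) - F (?v (insert i T))) \<le>
        real CARD('p) ^ (\<alpha> $ i) * padic_norm (?v T $ i - ?v (insert i T) $ i)"
      by (rule padic_lipschitz_single_coordinate[OF assms(1)])
        (simp_all add: trunc_vec_in_padic_int_vecs, simp add: trunc_vec_def)
    \<comment> \<open>What the truncation removes is a multiple of p^(r i), so its norm is at most
      p^(-r i).\<close>
    moreover have "?v T $ i - ?v (insert i T) $ i =
        of_nat (CARD('p) ^ r i * (m $ i div CARD('p) ^ r i))"
    proof -
      have "(of_nat (m $ i) :: 'p padic) =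
          of_nat (CARD('p) ^ r i * (m $ i div CARD('p) ^ r i) + m $ i mod CARD('p) ^ r i)"
        by (simp only: mult_div_mod_eq)
      also have "\<dots> = of_nat (CARD('p) ^ r i * (m $ i div CARD('p) ^ r i)) + of_nat (m $ i mod CARD('p) ^ r i)"
        by (rule of_nat_add)
      finally have "(of_nat (m $ i) :: 'p padic) - of_nat (m $ i mod CARD('p) ^ r i) =
          of_nat (CARD('p) ^ r i * (m $ i div CARD('p) ^ r i))"
        by (metis add_diff_cancel_right')
      thus ?thesis using i by (simp add: trunc_vec_def del: of_nat_mult)
    qed
    moreover have "real CARD('p) ^ (\<alpha> $ i) * (1 / real CARD('p)) ^ r i = ?B"
      using p0 power_int_diff[of "real CARD('p)" "int (\<alpha> $ i)" "int (r i)"]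
      by (simp add: power_one_over)
    ultimately show ?thesis
      using mult_left_mono[OF padic_norm_p_power_mult_le[of "r i" "m $ i div CARD('p) ^ r i", where 'p = 'p],
          of "real CARD('p) ^ (\<alpha> $ i)"]
      by (simp add: padic_norm_minus_one_power_mult del: of_nat_mult)
  qed
  hence "padic_norm (\<Sum>T\<in>Pow J. (- 1) ^ card T * F (?v T) + (- 1) ^ card (insert i T) * F (?v (insert i T))) \<le> ?B"
    using p0 by (intro padic_norm_sum_le) auto
  thus ?thesis
    unfolding I by (subst sum_Pow_insert) (auto simp: J)
qed

section \<open>The bound for the coefficients\<close>

theorem theorem3p2:
  fixes F :: "'p::prime_card padic ^ 'n \<Rightarrow> 'p padic"
    and A :: "nat ^ 'n \<Rightarrow> 'p padic"
    and \<alpha> :: "nat ^ 'n"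
    and m :: "nat ^ 'n"
  assumes "F \<in> padic_int_vecs \<rightarrow> padic_ints"
    and "continuous_on padic_int_vecs F"
    and "vdp_expansion F A"
    and "padic_lipschitz \<alpha> F"
    and "{i. m $ i \<ge> CARD('p)} \<noteq> {}"
  shows "padic_norm (A m) \<le> real CARD('p) powi
    (MIN i\<in>{i. m $ i \<ge> CARD('p)}. - \<lfloor>log (real CARD('p)) (real (m $ i))\<rfloor> + int (\<alpha> $ i))"
proof -
  let ?I = "{i. m $ i \<ge> CARD('p)}"
  let ?v = "\<lambda>i. - \<lfloor>log (real CARD('p)) (real (m $ i))\<rfloor> + int (\<alpha> $ i)"
  have p1: "CARD('p) > 1" using prime_gt_1_nat[OF prime_card[where 'a = 'p]] .
  have "\<exists>r. CARD('p) ^ r \<le> m $ i \<and> m $ i < CARD('p) ^ (r + 1)" if "i \<in> ?I" for i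
    using that p1 by (intro ex_power_ivl1) auto
  then obtain r where r: "\<And>i. i \<in> ?I \<Longrightarrow> CARD('p) ^ r i \<le> m $ i \<and> m $ i < CARD('p) ^ (r i + 1)"
    by metis
  have r_pos: "r i > 0" if "i \<in> ?I" for i
    using r[OF that] that by (cases "r i = 0") auto
  have log: "\<lfloor>log (real CARD('p)) (real (m $ i))\<rfloor> = int (r i)" if "i \<in> ?I" for i
    using r[OF that] that p1 by (intro floor_log_nat_eq_if) auto
  \<comment> \<open>The minimum is attained, so a single coordinate \<open>i\<close> of I(m) has to
    be treated.\<close>
  have "(MIN i\<in>?I. ?v i) \<in> ?v ` ?I"
    using assms(5) by (intro Min_in) auto
  then obtain i where i: "i \<in> ?I" "(MIN i\<in>?I. ?v i) = ?v i" by blast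
  define B where "B = real CARD('p) powi (- int (r i) + int (\<alpha> $ i))"
  have B: "B > 0" using p1 by (simp add: B_def)
  define D where "D G = (\<Sum>T\<in>Pow ?I. (- 1) ^ card T * G (trunc_vec r m T))" for G :: "'p padic ^ 'n \<Rightarrow> 'p padic"
  \<comment> \<open>The target bound \<open>B\<close> itself serves as the accuracy of the
    approximation: the ultrametric inequality absorbs an error of that size, so no limit has to be
    taken.\<close>
  obtain S0 where S0: "finite S0" "\<And>S x. finite S \<Longrightarrow> S0 \<subseteq> S \<Longrightarrow> x \<in> padic_int_vecs \<Longrightarrow>
      dist (\<Sum>k\<in>S. A k * vdp_E k x) (F x) < B"
    using assms(3) B unfolding vdp_expansion_def uniform_limit_iff eventually_finite_subsets_at_top
    by (metis subset_UNIV)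
  \<comment> \<open>Inserting \<open>m\<close> ensures that \<open>A m\<close> occurs in the finite
    partial sum.\<close>
  define S where "S = insert m S0"
  define P where "P x = (\<Sum>k\<in>S. A k * vdp_E k x)" for x
  have fin: "finite S" using S0 by (simp add: S_def)
  have "D P = (\<Sum>k\<in>S. A k * (\<Sum>T\<in>Pow ?I. (- 1) ^ card T * vdp_E k (trunc_vec r m T)))"
    unfolding D_def P_def sum_distrib_left by (subst sum.swap) (simp add: mult_ac)
  also have "\<dots> = (\<Sum>k\<in>S. A k * of_bool (k = m))"
    using r r_pos by (subst alternating_sum_vdp_E) auto
  also have "\<dots> = A m"
    using fin by (simp add: S_def of_bool_def if_distrib sum.delta cong: if_cong)
  \<comment> \<open>Additivity of \<open>D\<close> splits off the approximation error, a signed sum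
    of values of norm below \<open>B\<close>.\<close>
  finally have "A m = D F + D (\<lambda>x. P x - F x)"
    by (simp add: D_def sum.distrib[symmetric] algebra_simps)
  moreover have "padic_norm (D (\<lambda>x. P x - F x)) \<le> B"
    unfolding D_def
  proof (rule padic_norm_sum_le)
    fix T :: "'n set"
    let ?x = "trunc_vec r m T :: 'p padic ^ 'n"
    show "padic_norm ((- 1) ^ card T * (P ?x - F ?x)) \<le> B"
      using S0(2)[OF fin _ trunc_vec_in_padic_int_vecs, of r m T]
      by (simp add: padic_norm_minus_one_power_mult dist_padic_def P_def S_def subset_insertI)
  qed (use B in simp)
  moreover have "padic_norm (D F) \<le> B"
    unfolding D_def B_def by (rule alternating_sum_lipschitz_le[OF assms(4) i(1)])
  ultimately have "padic_norm (A m) \<le> B"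
    using padic_norm_add_le_max[of "D F" "D (\<lambda>x. P x - F x)"] by simp
  thus ?thesis unfolding i(2) B_def log[OF i(1)] .
qed

end
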